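(* Let $K=\mathbb{F}_q$, $n\ge 1$, let $A_0,\dots,A_n\subset K$ with $d_i=|A_i|$ and $2\le d_0\le d_1\le\cdots\le d_n$, and suppose that $\mathcal{X}=[A_0\times A_1\times\cdots\times A_n]\subset\mathbb{P}^n(K)$ is a projective nested cartesian set. Let $d\ge 0$ be an integer and let $C_{\mathcal X}(d)$ be the associated projective nested cartesian code. Then the length of $C_{\mathcal X}(d)$ is $$m=|\mathcal X|=1+\sum_{i=1}^n d_i d_{i+1}\cdots d_n,$$ and its dimension is $$\dim_K C_{\mathcal X}(d)=1+\sum_{j=1}^n\left[\sum_{k=0}^{j}(-1)^k\sum_{n+1-j\le i_1<\cdots<i_k\le n}\binom{j+d-1-(d_{i_1}+\cdots+d_{i_k})}{d-1-(d_{i_1}+\cdots+d_{i_k})}\right],$$ where for $k=0$ the inner sum is the single term $\binom{j+d-1}{d-1}$.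
   Context: $\mathbb{P}^n$ is the projective space over $K$. For non-empty $A_0,\dots,A_n\subset K$, $[A_0\times\cdots\times A_n]$ denotes the set of points $(a_0:\cdots:a_n)\in\mathbb{P}^n$ with $a_i\in A_i$ for all $i$ (not all zero). For $A,B\subset K$, $\frac{A}{B}:=\{a/b : a\in A,\ b\in B\setminus\{0\}\}$. The set $\mathcal X=[A_0\times\cdots\times A_n]$ is a projective nested cartesian set if (i) $0\in A_i$ for all $i=0,\dots,n$, and (ii) for every $i=1,\dots,n$ and every $j=i,\dots,n$ one has $\frac{A_j}{A_{i-1}}\subset A_j$. Let $S=K[X_0,\dots,X_n]$ and let $S_d$ be the $K$-vector space of homogeneous polynomials of degree $d$ together with $0$. Let $P_1,\dots,P_m$ be the points of $\mathcal X$, each written with its standard representative (first nonzero entry, from the left, equal to $1$). The code $C_{\mathcal X}(d)$ is the image of the linear evaluation map $\varphi_d:S_d\to K^{|\mathcal X|}$, $f\mapsto (f(P_1),\dots,f(P_m))$. The length of the code is $|\mathcal X|$ and its dimension is its dimension as a $K$-vector space. Convention: $\binom{a}{b}=0$ if $b<0$. *)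

theory Defs
  imports Complex_Main "HOL-Library.Function_Algebras" "HOL-Library.Poly_Mapping"
begin

section \<open>Projective space\<close>

text \<open>Vectors of \<open>K\<^sup>n\<^sup>+\<^sup>1\<close> are functions on \<open>nat\<close> vanishing outside the index set \<open>{0..n}\<close>.\<close>

definition nonzero_vecs :: "nat \<Rightarrow> (nat \<Rightarrow> 'a::field) set" where
  "nonzero_vecs n = {v. (\<forall>i. n < i \<longrightarrow> v i = 0) \<and> (\<exists>i. v i \<noteq> 0)}"

definition proportional :: "nat \<Rightarrow> ((nat \<Rightarrow> 'a::field) \<times> (nat \<Rightarrow> 'a)) set" where
  "proportional n = {(v, w). v \<in> nonzero_vecs n \<and> w \<in> nonzero_vecs n \<and>
     (\<exists>c. c \<noteq> 0 \<and> w = (\<lambda>i. c * v i))}"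

definition proj_space :: "nat \<Rightarrow> (nat \<Rightarrow> 'a::field) set set" where
  "proj_space n = nonzero_vecs n // proportional n"

lemma equiv_proportional:
  "equiv (nonzero_vecs n :: (nat \<Rightarrow> 'a::field) set) (proportional n)" (is "equiv ?V ?R")
proof (rule equivI)
  show "?R \<subseteq> ?V \<times> ?V"
    by (auto simp: proportional_def)
  show "refl_on ?V ?R"
    by (auto simp: refl_on_def proportional_def intro!: exI[of _ 1])
  show "sym ?R"
  proof (rule symI)
    fix v w :: "nat \<Rightarrow> 'a" assume "(v, w) \<in> proportional n"
    then obtain c where c: "c \<noteq> 0" "w = (\<lambda>i. c * v i)"
      and *: "v \<in> nonzero_vecs n" "w \<in> nonzero_vecs n"
      by (auto simp: proportional_def)
    then have "v = (\<lambda>i. inverse c * w i)" by auto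
    with c(1) * show "(w, v) \<in> proportional n"
      unfolding proportional_def using nonzero_imp_inverse_nonzero by blast
  qed
  show "trans ?R"
  proof (rule transI)
    fix u v w :: "nat \<Rightarrow> 'a"
    assume "(u, v) \<in> proportional n" "(v, w) \<in> proportional n"
    then obtain b c where "b \<noteq> 0" "v = (\<lambda>i. b * u i)" "c \<noteq> 0" "w = (\<lambda>i. c * v i)"
      and *: "u \<in> nonzero_vecs n" "w \<in> nonzero_vecs n"
      by (auto simp: proportional_def)
    then have "c * b \<noteq> 0 \<and> w = (\<lambda>i. (c * b) * u i)" by (auto simp: mult.assoc)
    with * show "(u, w) \<in> proportional n" unfolding proportional_def by blast
  qed
qed

definition cartesian_points :: "nat \<Rightarrow> (nat \<Rightarrow> 'a::field set) \<Rightarrow> (nat \<Rightarrow> 'a) set set" where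
  "cartesian_points n A = {P \<in> proj_space n. \<exists>a\<in>P. \<forall>i\<le>n. a i \<in> A i}"

definition quot_set :: "'a::field set \<Rightarrow> 'a set \<Rightarrow> 'a set" where
  "quot_set A B = {a / b | a b. a \<in> A \<and> b \<in> B - {0}}"

definition projective_nested :: "nat \<Rightarrow> (nat \<Rightarrow> 'a::field set) \<Rightarrow> bool" where
  "projective_nested n A \<longleftrightarrow>
     (\<forall>i\<le>n. 0 \<in> A i) \<and>
     (\<forall>i\<in>{1..n}. \<forall>j\<in>{i..n}. quot_set (A j) (A (i - 1)) \<subseteq> A j)"

definition std_vec :: "nat \<Rightarrow> (nat \<Rightarrow> 'a::field) \<Rightarrow> bool" where
  "std_vec n v \<longleftrightarrow> (\<exists>i\<le>n. v i = 1 \<and> (\<forall>j<i. v j = 0))"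

definition std_rep :: "nat \<Rightarrow> (nat \<Rightarrow> 'a::field) set \<Rightarrow> (nat \<Rightarrow> 'a)" where
  "std_rep n P = (THE v. v \<in> P \<and> std_vec n v)"

lemma std_rep_unique:
  assumes "P \<in> proj_space n"
  shows "\<exists>!v. v \<in> P \<and> std_vec n v"
proof -
  obtain w where w: "w \<in> nonzero_vecs n" and P: "P = proportional n `` {w}"
    using assms by (auto simp: proj_space_def elim: quotientE)
  obtain i0 where "w i0 \<noteq> 0" using w by (auto simp: nonzero_vecs_def)
  define i where "i = (LEAST i. w i \<noteq> 0)"
  have i: "w i \<noteq> 0" "\<And>j. j < i \<Longrightarrow> w j = 0"
    unfolding i_def by (rule LeastI[of _ i0], fact) (auto dest: not_less_Least)
  have "i \<le> n" using i(1) w by (auto simp: nonzero_vecs_def intro: leI)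
  show ?thesis
  proof (rule ex1I[of _ "\<lambda>k. inverse (w i) * w k"], intro conjI)
    have "(\<lambda>k. inverse (w i) * w k) \<in> nonzero_vecs n"
      using w i(1) by (auto simp: nonzero_vecs_def)
    then show "(\<lambda>k. inverse (w i) * w k) \<in> P"
      unfolding P proportional_def using w i(1) nonzero_imp_inverse_nonzero by blast
    show "std_vec n (\<lambda>k. inverse (w i) * w k)"
      using i \<open>i \<le> n\<close> by (auto simp: std_vec_def)
  next
    fix v assume v: "v \<in> P \<and> std_vec n v"
    then obtain c where c: "c \<noteq> 0" "v = (\<lambda>k. c * w k)"
      by (auto simp: P proportional_def)
    obtain l where l: "v l = 1" "\<And>j. j < l \<Longrightarrow> v j = 0"
      using v by (auto simp: std_vec_def)
    have "l = i"
    proof (rule linorder_cases[of l i])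
      assume "l < i" then show ?thesis using i(2)[of l] l(1) c by simp
    next
      assume "i < l" then show ?thesis using l(2)[of i] i(1) c by simp
    qed
    then have "c = inverse (w i)" using l(1) c i(1) by (simp add: field_simps)
    then show "v = (\<lambda>k. inverse (w i) * w k)" using c by simp
  qed
qed

section \<open>Homogeneous polynomials and evaluation\<close>

text \<open>A polynomial is a finitely supported map from monomials to coefficients, a monomial
  being the finitely supported map of its exponents.\<close>

type_synonym 'a mpol = "(nat \<Rightarrow>\<^sub>0 nat) \<Rightarrow>\<^sub>0 'a"

definition monom_degree :: "(nat \<Rightarrow>\<^sub>0 nat) \<Rightarrow> nat" where
  "monom_degree m = (\<Sum>i\<in>Poly_Mapping.keys m. Poly_Mapping.lookup m i)"

definition polys_in :: "nat \<Rightarrow> 'a::field mpol set" where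
  "polys_in n = {f. \<forall>m\<in>Poly_Mapping.keys f. Poly_Mapping.keys m \<subseteq> {0..n}}"

definition homogeneous_polys :: "nat \<Rightarrow> nat \<Rightarrow> 'a::field mpol set" where
  "homogeneous_polys n d =
     {f \<in> polys_in n. \<forall>m\<in>Poly_Mapping.keys f. monom_degree m = d}"

definition poly_eval :: "'a::field mpol \<Rightarrow> (nat \<Rightarrow> 'a) \<Rightarrow> 'a" where
  "poly_eval f x = (\<Sum>m\<in>Poly_Mapping.keys f. Poly_Mapping.lookup f m *
     (\<Prod>i\<in>Poly_Mapping.keys m. x i ^ Poly_Mapping.lookup m i))"

lemma poly_eval_superset:
  assumes "finite M" "Poly_Mapping.keys f \<subseteq> M"
  shows "poly_eval f x = (\<Sum>m\<in>M. Poly_Mapping.lookup f m *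
     (\<Prod>i\<in>Poly_Mapping.keys m. x i ^ Poly_Mapping.lookup m i))"
  unfolding poly_eval_def using assms
  by (intro sum.mono_neutral_left) (auto simp: in_keys_iff)

lemma poly_eval_add: "poly_eval (f + g) x = poly_eval f x + poly_eval g x"
proof -
  let ?M = "Poly_Mapping.keys f \<union> Poly_Mapping.keys g"
  have "finite ?M" "Poly_Mapping.keys (f + g) \<subseteq> ?M"
    by (auto dest: Poly_Mapping.keys_add[THEN subsetD])
  then show ?thesis
    by (simp add: poly_eval_superset[of ?M] lookup_add distrib_right sum.distrib)
qed

lemma poly_eval_scale:
  "poly_eval (Poly_Mapping.map ((*) c) f) x = c * poly_eval f x"
proof -
  have "Poly_Mapping.keys (Poly_Mapping.map ((*) c) f) \<subseteq> Poly_Mapping.keys f"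
    by (auto simp: in_keys_iff map.rep_eq when_def)
  then have "poly_eval (Poly_Mapping.map ((*) c) f) x =
      (\<Sum>m\<in>Poly_Mapping.keys f. Poly_Mapping.lookup (Poly_Mapping.map ((*) c) f) m *
        (\<Prod>i\<in>Poly_Mapping.keys m. x i ^ Poly_Mapping.lookup m i))"
    by (intro poly_eval_superset) auto
  also have "\<dots> = c * poly_eval f x"
    unfolding poly_eval_def sum_distrib_left
    by (intro sum.cong) (auto simp: map.rep_eq when_def mult.assoc)
  finally show ?thesis .
qed

section \<open>The code\<close>

definition vec_scale :: "'a::field \<Rightarrow> (nat \<Rightarrow> 'a) \<Rightarrow> (nat \<Rightarrow> 'a)" where
  "vec_scale c v = (\<lambda>i. c * v i)"

global_interpretation coord: vector_space "vec_scale :: 'a::field \<Rightarrow> _"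
  by standard (auto simp: vec_scale_def algebra_simps)

text \<open>\<open>K\<^sup>m\<close> is the space of functions on \<open>nat\<close> vanishing outside \<open>{1..m}\<close>; \<open>p 1, \<dots>, p m\<close>
  is an enumeration of the points.\<close>

definition eval_map ::
    "nat \<Rightarrow> nat \<Rightarrow> (nat \<Rightarrow> (nat \<Rightarrow> 'a::field) set) \<Rightarrow> 'a mpol \<Rightarrow> (nat \<Rightarrow> 'a)" where
  "eval_map n m p f = (\<lambda>i. if i \<in> {1..m} then poly_eval f (std_rep n (p i)) else 0)"

definition nested_code ::
    "nat \<Rightarrow> nat \<Rightarrow> (nat \<Rightarrow> (nat \<Rightarrow> 'a::field) set) \<Rightarrow> nat \<Rightarrow> (nat \<Rightarrow> 'a) set" where
  "nested_code n m p d = eval_map n m p ` homogeneous_polys n d"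

lemma subspace_nested_code: "coord.subspace (nested_code n m p d)"
proof (rule coord.subspaceI)
  have "eval_map n m p 0 = 0" "0 \<in> homogeneous_polys n d"
    by (auto simp: eval_map_def poly_eval_def homogeneous_polys_def polys_in_def)
  then show "0 \<in> nested_code n m p d" unfolding nested_code_def by (metis imageI)
next
  fix v w assume "v \<in> nested_code n m p d" "w \<in> nested_code n m p d"
  then obtain f g where fg: "v = eval_map n m p f" "w = eval_map n m p g"
    "f \<in> homogeneous_polys n d" "g \<in> homogeneous_polys n d"
    by (auto simp: nested_code_def)
  have "v + w = eval_map n m p (f + g)"
    by (auto simp: fg eval_map_def poly_eval_add)
  moreover have "f + g \<in> homogeneous_polys n d"
    using fg(3,4) Poly_Mapping.keys_add[of f g]
    unfolding homogeneous_polys_def polys_in_def by blast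
  ultimately show "v + w \<in> nested_code n m p d" by (auto simp: nested_code_def)
next
  fix c v assume "v \<in> nested_code n m p d"
  then obtain f where f: "v = eval_map n m p f" "f \<in> homogeneous_polys n d"
    by (auto simp: nested_code_def)
  have "vec_scale c v = eval_map n m p (Poly_Mapping.map ((*) c) f)"
    by (auto simp: f vec_scale_def eval_map_def poly_eval_scale)
  moreover have "Poly_Mapping.keys (Poly_Mapping.map ((*) c) f) \<subseteq> Poly_Mapping.keys f"
    by (auto simp: in_keys_iff map.rep_eq when_def)
  then have "Poly_Mapping.map ((*) c) f \<in> homogeneous_polys n d"
    using f(2) unfolding homogeneous_polys_def polys_in_def by blast
  ultimately show "vec_scale c v \<in> nested_code n m p d" by (auto simp: nested_code_def)
qed

text \<open>Binomial coefficients with integer arguments, zero when the lower one is negative. The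
  truncation of a negative upper argument is harmless: the upper argument always exceeds the
  lower one by a natural number here.\<close>

definition int_binomial :: "int \<Rightarrow> int \<Rightarrow> int" where
  "int_binomial a b = (if b < 0 then 0 else int (nat a choose nat b))"

end

theory Submission
  imports Defs "HOL-Library.FuncSet" "HOL-Computational_Algebra.Polynomial"
begin

text \<open>A standard representative lies in the cartesian set exactly when its coordinates after the
  leading \<open>1\<close>, at position \<open>i\<close>, lie in the sets \<open>A\<^sub>j\<close>; this gives the length. At every such point
  \<open>X\<^sub>i \<Prod>\<^bsub>a \<in> A\<^sub>l\<^esub> (X\<^sub>l - a X\<^sub>i)\<close> vanishes for \<open>i < l\<close>, so every monomial of degree \<open>d\<close> with leading variable
  \<open>X\<^sub>i\<close> can be rewritten, as a function on the points, through monomials with the same leading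
  variable and exponent of \<open>X\<^sub>l\<close> below \<open>d\<^sub>l\<close> for all \<open>l > i\<close>. These reduced monomials are linearly
  independent: on the points with leading index \<open>i\<close> they restrict to reduced polynomials on a grid.
  The reduced monomials with leading variable \<open>X\<^sub>n\<^sub>-\<^sub>j\<close> correspond to exponents in \<open>j\<close> variables
  with bounds \<open>d\<^sub>l\<close> and sum below \<open>d\<close>, whose number is the alternating sum of binomials.\<close>

section \<open>Standard representatives\<close>

definition lead_point :: "nat \<Rightarrow> nat \<Rightarrow> (nat \<Rightarrow> 'a::field) \<Rightarrow> (nat \<Rightarrow> 'a)" where
  "lead_point n i g = (\<lambda>j. if j = i then 1 else if j \<in> {i<..n} then g j else 0)"

text \<open>Extensional functions in \<open>PiE\<close> give each point exactly one pair
  \<open>(i, g)\<close>, so points can be counted by pairs.\<close>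

definition std_points :: "nat \<Rightarrow> (nat \<Rightarrow> 'a::field set) \<Rightarrow> (nat \<Rightarrow> 'a) set" where
  "std_points n A = (\<lambda>(i, g). lead_point n i g) ` (SIGMA i:{..n}. PiE {i<..n} A)"

lemma lead_point_in_std_points:
  assumes "i \<le> n" "\<And>l. l \<in> {i<..n} \<Longrightarrow> g l \<in> A l"
  shows "lead_point n i g \<in> std_points n A"
proof -
  have "lead_point n i g = lead_point n i (restrict g {i<..n})"
    by (auto simp: lead_point_def)
  then show ?thesis
    using assms by (auto simp: std_points_def intro!: image_eqI[of _ _ "(i, restrict g {i<..n})"])
qed

lemma std_pointsE:
  assumes "x \<in> std_points n A"
  obtains i where "i \<le> n" "x i = 1" "\<And>j. j < i \<Longrightarrow> x j = 0"
    "\<And>j. j \<in> {i<..n} \<Longrightarrow> x j \<in> A j" "\<And>j. j > n \<Longrightarrow> x j = 0"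
  using assms by (force simp: std_points_def lead_point_def)

lemma inj_on_lead_point:
  "inj_on (\<lambda>(i, g). lead_point n i g :: nat \<Rightarrow> 'a::field) (SIGMA i:{..n}. PiE {i<..n} A)"
proof (rule inj_onI, clarify)
  fix i i' g g'
  assume g: "g \<in> PiE {i<..n} A" "g' \<in> PiE {i'<..n} A"
    and eq: "lead_point n i g = (lead_point n i' g' :: nat \<Rightarrow> 'a)"
  have *: "lead_point n i g j = lead_point n i' g' j" for j
    by (simp add: eq)
  \<comment> \<open>At the smaller of two distinct leading indices one vector has entry 1 and the
    other 0.\<close>
  have i: "i' = i"
    using *[of i] *[of i'] by (cases i i' rule: linorder_cases) (auto simp: lead_point_def)
  moreover have "g = g'"
  proof (rule PiE_ext)
    show "g \<in> PiE {i<..n} A" "g' \<in> PiE {i<..n} A"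
      using g i by auto
    show "g j = g' j" if "j \<in> {i<..n}" for j
      using *[of j] that i by (auto simp: lead_point_def)
  qed
  ultimately show "i = i' \<and> g = g'"
    by simp
qed

lemma card_std_points:
  fixes A :: "nat \<Rightarrow> 'a::{field,finite} set"
  shows "card (std_points n A) = 1 + (\<Sum>i=1..n. \<Prod>l=i..n. card (A l))"
proof -
  have "card (std_points n A) = (\<Sum>i\<le>n. \<Prod>l\<in>{i<..n}. card (A l))"
    unfolding std_points_def card_image[OF inj_on_lead_point]
    by (subst card_SigmaI) (auto simp: card_PiE intro!: finite_PiE)
  \<comment> \<open>Leading index \<open>n\<close> contributes an empty product: the single point
    with only its last coordinate nonzero.\<close>
  also have "\<dots> = 1 + (\<Sum>i<n. \<Prod>l\<in>{i<..n}. card (A l))"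
    by (simp flip: lessThan_Suc_atMost)
  also have "(\<Sum>i<n. \<Prod>l\<in>{i<..n}. card (A l)) = (\<Sum>i=1..n. \<Prod>l=i..n. card (A l))"
    by (rule sum.reindex_bij_witness[of _ "\<lambda>i. i - 1" Suc])
       (auto simp: atLeastSucAtMost_greaterThanAtMost)
  finally show ?thesis .
qed

section \<open>Nestedness and the normalisation of points\<close>

lemma projective_nested_div_closed:
  assumes "projective_nested n A" "i < j" "j \<le> n" "b \<in> A i" "b \<noteq> 0" "a \<in> A j"
  shows "a / b \<in> A j"
proof -
  have "\<forall>i\<in>{1..n}. \<forall>j\<in>{i..n}. quot_set (A j) (A (i - 1)) \<subseteq> A j"
    using assms(1) by (simp add: projective_nested_def)
  from this[rule_format, of "Suc i" j] show ?thesis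
    using assms(2-) by (auto simp: quot_set_def)
qed

text \<open>Division by a nonzero \<open>b \<in> A i\<close> is an injective self-map of the finite set \<open>A j\<close>,
  hence a permutation of it, and multiplication by \<open>b\<close> is its inverse.\<close>

lemma projective_nested_mult_closed:
  fixes A :: "nat \<Rightarrow> 'a::{field,finite} set"
  assumes "projective_nested n A" "i < j" "j \<le> n" "b \<in> A i" "b \<noteq> 0" "a \<in> A j"
  shows "b * a \<in> A j"
proof -
  have "(\<lambda>x. x / b) ` A j \<subseteq> A j"
    using projective_nested_div_closed[OF assms(1-5)] by auto
  moreover have "inj_on (\<lambda>x. x / b) (A j)"
    using assms by (auto simp: inj_on_def)
  ultimately have "(\<lambda>x. x / b) ` A j = A j"
    by (intro endo_inj_surj) auto
  then obtain c where "c \<in> A j" "a = c / b"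
    using assms by blast
  then show ?thesis
    using assms by simp
qed

text \<open>If \<open>i\<close> is the leading index the divisor is 1; otherwise \<open>x i\<close>
  is a nonzero element of \<open>A i\<close>. This makes the vanishing relation for
  \<open>A l\<close> available at every point.\<close>

lemma std_points_div_closed:
  assumes "projective_nested n A" "x \<in> std_points n A" "i < l" "l \<le> n" "x i \<noteq> 0"
  shows "x l / x i \<in> A l"
proof -
  from assms(2) obtain k where k: "k \<le> n" "x k = 1" "\<And>j. j < k \<Longrightarrow> x j = 0"
    "\<And>j. j \<in> {k<..n} \<Longrightarrow> x j \<in> A j"
    by (elim std_pointsE) metis
  have "k \<le> i"
    using k(3) assms(5) by (meson not_le)
  then show ?thesis
    using k assms by (cases "k = i") (auto intro!: projective_nested_div_closed[of n A])
qed

text \<open>Dividing a vector with entries in the sets by its leading entry keeps the later entries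
  there. Conversely, a standard vector is multiplied by a nonzero \<open>b\<close> in
  \<open>A i\<close>, because 1 itself need not lie in \<open>A i\<close>.\<close>

lemma bij_betw_std_rep:
  fixes A :: "nat \<Rightarrow> 'a::{field,finite} set"
  assumes nested: "projective_nested n A" and two: "\<And>i. i \<le> n \<Longrightarrow> 2 \<le> card (A i)"
  shows "bij_betw (std_rep n) (cartesian_points n A) (std_points n A)"
proof -
  have rep: "std_rep n P \<in> P \<and> std_vec n (std_rep n P)" if "P \<in> proj_space n" for P :: "(nat \<Rightarrow> 'a) set"
    unfolding std_rep_def by (rule theI'[OF std_rep_unique[OF that]])
  have cls: "P = proportional n `` {v}" if "P \<in> proj_space n" "v \<in> P" for P and v :: "nat \<Rightarrow> 'a"
    using that equiv_proportional[of n]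
    by (metis Image_singleton_iff equiv_class_eq proj_space_def quotientE)
  have zero: "0 \<in> A i" if "i \<le> n" for i
    using nested that by (auto simp: projective_nested_def)
  show ?thesis
    unfolding bij_betw_def
  proof (intro conjI set_eqI iffI)
    show "inj_on (std_rep n) (cartesian_points n A)"
      by (rule inj_onI) (metis (lifting) cartesian_points_def cls mem_Collect_eq rep)
  next
    fix v assume "v \<in> std_rep n ` cartesian_points n A"
    then obtain P a where v: "v = std_rep n P" and P: "P \<in> proj_space n" "a \<in> P"
      and a: "\<forall>i\<le>n. a i \<in> A i"
      by (auto simp: cartesian_points_def)
    obtain i where i: "i \<le> n" "v i = 1" "\<forall>j<i. v j = 0"
      using rep[OF P(1)] by (auto simp: std_vec_def v)
    have "(v, a) \<in> proportional n"
      using cls[OF P(1), of v] rep[OF P(1)] P(2) v by auto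
    then obtain c where c: "c \<noteq> 0" "a = (\<lambda>j. c * v j)" and vn: "v \<in> nonzero_vecs n"
      by (auto simp: proportional_def)
    \<comment> \<open>Since \<open>v i = 1\<close>, the scalar \<open>c\<close> is
      \<open>a i\<close>, so \<open>v j\<close> is the quotient \<open>a j / a i\<close>.\<close>
    have "v j \<in> A j" if "j \<in> {i<..n}" for j
    proof -
      have "a j / a i \<in> A j"
        using a[rule_format, of i] a[rule_format, of j] that c i(1,2)
        by (intro projective_nested_div_closed[OF nested, of i j]) auto
      then show ?thesis
        using c i by simp
    qed
    then have "lead_point n i v \<in> std_points n A"
      using i by (intro lead_point_in_std_points) auto
    also have "lead_point n i v = v"
      using i vn by (auto simp: lead_point_def nonzero_vecs_def fun_eq_iff not_less)
    finally show "v \<in> std_points n A" .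
  next
    fix v assume v: "v \<in> std_points n A"
    then obtain i where i: "i \<le> n" "v i = 1" "\<And>j. j < i \<Longrightarrow> v j = 0"
      "\<And>j. j \<in> {i<..n} \<Longrightarrow> v j \<in> A j" "\<And>j. j > n \<Longrightarrow> v j = 0"
      by (elim std_pointsE) metis
    have vn: "v \<in> nonzero_vecs n"
      using i by (auto simp: nonzero_vecs_def intro!: exI[of _ i])
    have "\<exists>b\<in>A i. b \<noteq> 0"
    proof (rule ccontr)
      assume "\<not> ?thesis"
      then have "A i \<subseteq> {0}"
        by blast
      then have "card (A i) \<le> card {0::'a}"
        by (intro card_mono) auto
      then show False
        using two[OF i(1)] by simp
    qed
    then obtain b where b: "b \<in> A i" "b \<noteq> 0"
      by blast
    define a where "a = (\<lambda>j. b * v j)"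
    have aA: "a j \<in> A j" if "j \<le> n" for j
    proof (cases j i rule: linorder_cases)
      case less
      then show ?thesis
        using i(3) zero[OF that] by (simp add: a_def)
    next
      case equal
      then show ?thesis
        using i b by (simp add: a_def)
    next
      case greater
      then show ?thesis
        unfolding a_def using that b i(4) by (intro projective_nested_mult_closed[OF nested greater]) auto
    qed
    define P where "P = proportional n `` {v}"
    have P: "P \<in> proj_space n"
      using vn by (auto simp: P_def proj_space_def intro: quotientI)
    have "a \<in> nonzero_vecs n"
      using vn b by (auto simp: a_def nonzero_vecs_def)
    then have "a \<in> P"
      using vn b(2) unfolding P_def proportional_def a_def by blast
    moreover have "v \<in> P"
      using equiv_class_self[OF equiv_proportional vn] by (simp add: P_def)
    moreover have "std_vec n v"
      using i by (auto simp: std_vec_def)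
    ultimately have "v = std_rep n P" "P \<in> cartesian_points n A"
      using P rep[OF P] std_rep_unique[OF P] aA by (auto simp: cartesian_points_def)
    then show "v \<in> std_rep n ` cartesian_points n A"
      by blast
  qed
qed


section \<open>Reduced monomials\<close>

text \<open>A nonzero polynomial of degree below \<open>card B\<close> cannot vanish on all of
  \<open>B\<close>.\<close>

lemma unique_reduced_poly_on_finite_set:
  fixes c :: "nat \<Rightarrow> 'a::field"
  assumes "finite B" "\<And>t. t \<in> B \<Longrightarrow> (\<Sum>k<card B. c k * t ^ k) = 0" "k < card B"
  shows "c k = 0"
proof -
  define f where "f = (\<Sum>k<card B. monom (c k) k)"
  have coeff_f: "coeff f j = (if j < card B then c j else 0)" for j
    by (simp add: f_def coeff_sum)
  have "degree f < card B"
    using assms(3) by (intro degree_lessI) (auto simp: coeff_f)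
  then have "f = 0"
    using assms(1,2)
    by (intro poly_eqI_degree[of B]) (auto simp: f_def poly_sum poly_monom intro: le_less_trans)
  then show ?thesis
    using coeff_f[of k] assms(3) by simp
qed

text \<open>Induction on the number of variables: with the others fixed, the polynomial in
  \<open>x a\<close> is reduced and vanishes on \<open>A a\<close>, so its coefficients vanish;
  these are reduced polynomials on the smaller grid.\<close>

lemma unique_reduced_poly_on_grid:
  fixes c :: "(nat \<Rightarrow> nat) \<Rightarrow> 'a::field"
  assumes "finite L" "\<And>l. l \<in> L \<Longrightarrow> finite (A l)"
    and "\<And>x. (\<And>l. l \<in> L \<Longrightarrow> x l \<in> A l) \<Longrightarrow>
      (\<Sum>e\<in>PiE L (\<lambda>l. {..<card (A l)}). c e * (\<Prod>l\<in>L. x l ^ e l)) = 0"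
    and "e \<in> PiE L (\<lambda>l. {..<card (A l)})"
  shows "c e = 0"
  using assms
proof (induction L arbitrary: c e rule: finite_induct)
  case empty
  then show ?case
    by simp
next
  case (insert a L)
  let ?E = "PiE L (\<lambda>l. {..<card (A l)})"
  have split: "(\<Sum>e\<in>PiE (insert a L) (\<lambda>l. {..<card (A l)}). c e * (\<Prod>l\<in>insert a L. x l ^ e l)) =
      (\<Sum>k<card (A a). (\<Sum>e\<in>?E. c (e(a := k)) * (\<Prod>l\<in>L. x l ^ e l)) * x a ^ k)" for x :: "nat \<Rightarrow> 'a"
  proof -
    have "(\<Prod>l\<in>L. x l ^ (if l = a then k else e l)) = (\<Prod>l\<in>L. x l ^ e l)" for e k
      using insert.hyps by (intro prod.cong) auto
    then show ?thesis
      unfolding PiE_insert_eq sum.reindex[OF inj_combinator[OF insert.hyps(2), of "\<lambda>l. {..<card (A l)}"]] sum_distrib_right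
      using insert.hyps
      by (simp add: sum.cartesian_product case_prod_unfold mult_ac)
  qed
  have "c (e'(a := k)) = 0" if e': "e' \<in> ?E" and k: "k < card (A a)" for e' k
  proof (rule insert.IH[OF _ _ e'])
    fix x :: "nat \<Rightarrow> 'a" assume x: "\<And>l. l \<in> L \<Longrightarrow> x l \<in> A l"
    show "(\<Sum>e\<in>?E. c (e(a := k)) * (\<Prod>l\<in>L. x l ^ e l)) = 0"
    proof (rule unique_reduced_poly_on_finite_set[of "A a" "\<lambda>k. \<Sum>e\<in>?E. c (e(a := k)) * (\<Prod>l\<in>L. x l ^ e l)", OF _ _ k])
      fix t assume "t \<in> A a"
      then have "(\<Sum>e\<in>PiE (insert a L) (\<lambda>l. {..<card (A l)}).
          c e * (\<Prod>l\<in>insert a L. (x(a := t)) l ^ e l)) = 0"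
        using x insert.hyps(2) by (intro insert.prems(2)) auto
      moreover have "(\<Prod>l\<in>L. (x(a := t)) l ^ e l) = (\<Prod>l\<in>L. x l ^ e l)" for e
        using insert.hyps by (intro prod.cong) auto
      ultimately show "(\<Sum>k<card (A a). (\<Sum>e\<in>?E. c (e(a := k)) * (\<Prod>l\<in>L. x l ^ e l)) * t ^ k) = 0"
        unfolding split by simp
    qed (use insert.prems in auto)
  qed (use insert.prems in auto)
  moreover obtain e' k where "e' \<in> ?E" "k < card (A a)" "e = e'(a := k)"
    using insert.prems(3) unfolding PiE_insert_eq by auto
  ultimately show ?case
    by metis
qed

text \<open>The extra factor \<open>y\<close> makes the relation hold at \<open>y = 0\<close> as well.\<close>

lemma homogenised_vanishing_relation:
  fixes B :: "'a::field set"
  assumes "finite B"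
  obtains c where
    "\<And>x y. (y \<noteq> 0 \<Longrightarrow> x / y \<in> B) \<Longrightarrow>
      y * x ^ card B = (\<Sum>k<card B. c k * (y ^ Suc (card B - k) * x ^ k))"
proof -
  \<comment> \<open>The monic polynomial with root set \<open>B\<close>. Multiplying
    \<open>poly g (x / y) = 0\<close> by \<open>y ^ Suc (card B)\<close> and isolating the top term
    gives the relation.\<close>
  define g where "g = (\<Prod>a\<in>B. [:- a, 1:])"
  have deg: "degree g = card B"
    unfolding g_def by (subst degree_prod_eq_sum_degree) auto
  have lead: "coeff g (card B) = 1"
    using lead_coeff_prod[of "\<lambda>a. [:- a, 1:]" B] by (simp flip: g_def deg)
  show thesis
  proof (rule that[of "\<lambda>k. - coeff g k"])
    fix x y :: 'a assume xy: "y \<noteq> 0 \<Longrightarrow> x / y \<in> B"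
    have "(\<Sum>k\<le>card B. coeff g k * (y ^ Suc (card B - k) * x ^ k)) = 0"
    proof (cases "y = 0")
      case False
      have "y ^ Suc (card B - k) * x ^ k = y ^ Suc (card B) * (x / y) ^ k" if "k \<le> card B" for k
        using that False by (simp add: power_divide power_diff field_simps)
      then have "(\<Sum>k\<le>card B. coeff g k * (y ^ Suc (card B - k) * x ^ k)) =
          y ^ Suc (card B) * poly g (x / y)"
        unfolding poly_altdef deg sum_distrib_left by (intro sum.cong) auto
      also have "poly g (x / y) = 0"
        using xy[OF False] assms by (auto simp: g_def poly_prod)
      finally show ?thesis
        by simp
    qed simp
    then show "y * x ^ card B = (\<Sum>k<card B. - coeff g k * (y ^ Suc (card B - k) * x ^ k))"
      by (simp flip: lessThan_Suc_atMost add: lead sum_negf eq_neg_iff_add_eq_0 add.commute)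
  qed
qed

text \<open>A monomial in the variables after \<open>X_i\<close>, homogenised to degree
  \<open>d\<close> by \<open>X_i\<close>. The subtraction never truncates in the uses below: either
  the sum is less than \<open>d\<close>, or \<open>i = n\<close> and it is empty.\<close>

definition lead_monom :: "nat \<Rightarrow> nat \<Rightarrow> nat \<Rightarrow> (nat \<Rightarrow> nat) \<Rightarrow> (nat \<Rightarrow> 'a::field) \<Rightarrow> 'a" where
  "lead_monom n d i e x = x i ^ (d - sum e {i<..n}) * (\<Prod>l\<in>{i<..n}. x l ^ e l)"

text \<open>The condition \<open>sum e {i<..n} < d\<close> makes the exponent of the leading variable positive. For
  \<open>i = n\<close> it is waived, so that for \<open>d = 0\<close> the constant is counted, once.\<close>

definition reduced_exponents :: "(nat \<Rightarrow> 'a set) \<Rightarrow> nat \<Rightarrow> nat \<Rightarrow> nat \<Rightarrow> (nat \<Rightarrow> nat) set" where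
  "reduced_exponents A n d i =
     {e \<in> PiE {i<..n} (\<lambda>l. {..<card (A l)}). i = n \<or> sum e {i<..n} < d}"

text \<open>Vanishing of the combination is propagated from the points with leading index \<open>n\<close> down to
  those with leading index \<open>i\<close>: a monomial with leading variable \<open>j < i\<close> vanishes there, and
  the coefficients for \<open>j > i\<close> are already known to be zero.\<close>

lemma lead_monoms_independent:
  fixes A :: "nat \<Rightarrow> 'a::{field,finite} set"
  assumes zero: "\<And>x. x \<in> std_points n A \<Longrightarrow>
      (\<Sum>i\<le>n. \<Sum>e\<in>reduced_exponents A n d i. c i e * lead_monom n d i e x) = 0"
    and "i \<le> n" "e \<in> reduced_exponents A n d i"
  shows "c i e = 0"
  using assms(2,3)
proof (induction "n - i" arbitrary: i e rule: less_induct)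
  case less
  let ?E = "PiE {i<..n} (\<lambda>l. {..<card (A l)})"
  \<comment> \<open>Extension by zero to the whole exponent box, over which the grid lemma
    sums.\<close>
  let ?c = "\<lambda>e. if e \<in> reduced_exponents A n d i then c i e else 0"
  have "?c e = 0"
  proof (rule unique_reduced_poly_on_grid[where L = "{i<..n}" and A = A and c = ?c])
    fix x :: "nat \<Rightarrow> 'a" assume x: "\<And>l. l \<in> {i<..n} \<Longrightarrow> x l \<in> A l"
    let ?v = "lead_point n i x"
    have other: "(\<Sum>e\<in>reduced_exponents A n d j. c j e * lead_monom n d j e ?v) = 0"
      if "j \<in> {..n} - {i}" for j
    proof (cases "j < i")
      case True
      \<comment> \<open>As \<open>j < i \<le> n\<close>, the exponent of \<open>x j\<close> is
        positive, and that coordinate of \<open>?v\<close> is 0.\<close>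
      then show ?thesis
        using that less.prems(1)
        by (intro sum.neutral) (auto simp: lead_monom_def lead_point_def reduced_exponents_def)
    next
      case False
      then have "n - j < n - i" "j \<le> n"
        using that by auto
      then show ?thesis
        using less.hyps by (intro sum.neutral) auto
    qed
    have "(\<Sum>e\<in>?E. ?c e * (\<Prod>l\<in>{i<..n}. x l ^ e l)) =
        (\<Sum>e\<in>reduced_exponents A n d i. c i e * (\<Prod>l\<in>{i<..n}. x l ^ e l))"
      by (intro sum.mono_neutral_cong_right) (auto simp: reduced_exponents_def intro!: finite_PiE)
    also have "\<dots> = (\<Sum>e\<in>reduced_exponents A n d i. c i e * lead_monom n d i e ?v)"
      by (simp add: lead_monom_def lead_point_def)
    also have "\<dots> = (\<Sum>j\<le>n. \<Sum>e\<in>reduced_exponents A n d j. c j e * lead_monom n d j e ?v)"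
      using other less.prems(1) by (subst sum.remove[of _ i]) auto
    also have "\<dots> = 0"
      using less.prems(1) x by (intro zero lead_point_in_std_points) auto
    finally show "(\<Sum>e\<in>?E. ?c e * (\<Prod>l\<in>{i<..n}. x l ^ e l)) = 0" .
  qed (use less.prems in \<open>auto simp: reduced_exponents_def\<close>)
  then show ?case
    using less.prems by simp
qed


text \<open>The vanishing relation between \<open>x i\<close> and \<open>x l\<close> is multiplied
  by the remaining monomial. It uses one factor \<open>x i\<close>, available since
  \<open>sum e {i<..n} < d\<close>, and lowers the exponent of \<open>x l\<close>.\<close>

lemma lead_monom_reduction:
  fixes A :: "nat \<Rightarrow> 'a::{field,finite} set"
  assumes "projective_nested n A" and l: "l \<in> {i<..n}" "card (A l) \<le> e l"
    and d: "sum e {i<..n} < d"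
  obtains c where "\<And>x. x \<in> std_points n A \<Longrightarrow> lead_monom n d i e x =
    (\<Sum>k<card (A l). c k * lead_monom n d i (e(l := e l - card (A l) + k)) x)"
proof -
  obtain c where c: "\<And>x y. (y \<noteq> 0 \<Longrightarrow> x / y \<in> A l) \<Longrightarrow>
      y * x ^ card (A l) = (\<Sum>k<card (A l). c k * (y ^ Suc (card (A l) - k) * x ^ k))"
    using homogenised_vanishing_relation[of "A l"] by auto
  show thesis
  proof (rule that[of c])
    fix x assume x: "x \<in> std_points n A"
    define r where "r = e l - card (A l)"
    \<comment> \<open>The exponent of \<open>x i\<close> left after setting one factor aside for the
      relation.\<close>
    define t where "t = d - 1 - sum e {i<..n}"
    define R where "R = (\<Prod>j\<in>{i<..n} - {l}. x j ^ e j)"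
    have el: "e l = r + card (A l)"
      using l by (simp add: r_def)
    have sum_e: "sum e {i<..n} = e l + sum e ({i<..n} - {l})"
      using l by (intro sum.remove) auto
    have "lead_monom n d i e x = x i ^ Suc t * (x l ^ e l * R)"
    proof -
      have "(\<Prod>j\<in>{i<..n}. x j ^ e j) = x l ^ e l * R"
        unfolding R_def using l by (intro prod.remove) auto
      moreover have "d - sum e {i<..n} = Suc t"
        using d by (simp add: t_def)
      ultimately show ?thesis
        by (simp add: lead_monom_def)
    qed
    also have "\<dots> = x i ^ t * x l ^ r * R * (x i * x l ^ card (A l))"
      by (simp add: el power_add mult_ac)
    also have "x i * x l ^ card (A l) =
        (\<Sum>k<card (A l). c k * (x i ^ Suc (card (A l) - k) * x l ^ k))"
      using std_points_div_closed[OF assms(1) x, of i l] l by (intro c) auto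
    also have "x i ^ t * x l ^ r * R * \<dots> =
        (\<Sum>k<card (A l). c k * lead_monom n d i (e(l := e l - card (A l) + k)) x)"
      unfolding sum_distrib_left
    proof (rule sum.cong[OF refl])
      fix k assume k: "k \<in> {..<card (A l)}"
      let ?e = "e(l := e l - card (A l) + k)"
      have "sum ?e {i<..n} = r + k + sum e ({i<..n} - {l})"
        using l by (subst sum.remove[of _ l]) (auto simp: r_def)
      then have "d - sum ?e {i<..n} = t + Suc (card (A l) - k)"
        using k d sum_e el by (simp add: t_def)
      moreover have "(\<Prod>j\<in>{i<..n}. x j ^ ?e j) = x l ^ (r + k) * R"
        using l by (subst prod.remove[of _ l]) (auto simp: r_def R_def)
      ultimately have "lead_monom n d i ?e x =
          x i ^ (t + Suc (card (A l) - k)) * (x l ^ (r + k) * R)"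
        by (simp add: lead_monom_def)
      then show "x i ^ t * x l ^ r * R * (c k * (x i ^ Suc (card (A l) - k) * x l ^ k)) =
          c k * lead_monom n d i ?e x"
        by (simp add: power_add mult_ac)
    qed
    finally show "lead_monom n d i e x = \<dots>" .
  qed
qed

section \<open>A basis of the code\<close>

text \<open>Takes arbitrary functions, so that \<open>lead_monom\<close> can be evaluated without
  first being written as a polynomial.\<close>

definition point_vec :: "nat \<Rightarrow> (nat \<Rightarrow> nat \<Rightarrow> 'a) \<Rightarrow> ((nat \<Rightarrow> 'a) \<Rightarrow> 'a::field) \<Rightarrow> (nat \<Rightarrow> 'a)" where
  "point_vec m q F = (\<lambda>k. if k \<in> {1..m} then F (q k) else 0)"

lemma sum_fun_apply: "(\<Sum>i\<in>I. f i) x = (\<Sum>i\<in>I. f i x)"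
  by (induction I rule: infinite_finite_induct) auto

lemma point_vec_linear_combination:
  "point_vec m q (\<lambda>x. \<Sum>s\<in>S. c s * F s x) = (\<Sum>s\<in>S. vec_scale (c s) (point_vec m q (F s)))"
  by (rule ext) (auto simp: point_vec_def vec_scale_def sum_fun_apply intro!: sum.neutral)

lemma point_vec_cong:
  "(\<And>k. k \<in> {1..m} \<Longrightarrow> F (q k) = G (q k)) \<Longrightarrow> point_vec m q F = point_vec m q G"
  by (auto simp: point_vec_def)

definition reduced_vecs ::
    "(nat \<Rightarrow> 'a::field set) \<Rightarrow> nat \<Rightarrow> nat \<Rightarrow> nat \<Rightarrow> (nat \<Rightarrow> nat \<Rightarrow> 'a) \<Rightarrow> (nat \<Rightarrow> 'a) set" where
  "reduced_vecs A n d m q =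
     (\<lambda>(i, e). point_vec m q (lead_monom n d i e)) ` (SIGMA i:{..n}. reduced_exponents A n d i)"

text \<open>Each reduction lowers the total exponent after the leading variable and keeps the
  leading index, so it ends at reduced monomials.\<close>

lemma lead_monom_in_span:
  fixes A :: "nat \<Rightarrow> 'a::{field,finite} set"
  assumes "projective_nested n A" and q: "\<And>k. k \<in> {1..m} \<Longrightarrow> q k \<in> std_points n A"
    and "i \<le> n" "i = n \<or> sum e {i<..n} < d"
  shows "point_vec m q (lead_monom n d i e) \<in> coord.span (reduced_vecs A n d m q)"
  using assms(4)
proof (induction "sum e {i<..n}" arbitrary: e rule: less_induct)
  case less
  show ?case
  proof (cases "\<forall>l\<in>{i<..n}. e l < card (A l)")
    case True
    then have "restrict e {i<..n} \<in> reduced_exponents A n d i"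
      using less.prems by (auto simp: reduced_exponents_def)
    moreover have "lead_monom n d i (restrict e {i<..n}) = (lead_monom n d i e :: (nat \<Rightarrow> 'a) \<Rightarrow> 'a)"
      by (simp add: lead_monom_def fun_eq_iff)
    ultimately show ?thesis
      using assms(3) unfolding reduced_vecs_def
      by (intro coord.span_base image_eqI[of _ _ "(i, restrict e {i<..n})"]) auto
  next
    case False
    then obtain l where l: "l \<in> {i<..n}" "card (A l) \<le> e l"
      by auto
    then have d: "sum e {i<..n} < d"
      using less.prems by auto
    let ?e = "\<lambda>k. e(l := e l - card (A l) + k)"
    obtain c where c: "\<And>x. x \<in> std_points n A \<Longrightarrow> lead_monom n d i e x =
        (\<Sum>k<card (A l). c k * lead_monom n d i (?e k) x)"
      using lead_monom_reduction[OF assms(1) l d] by blast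
    have "point_vec m q (lead_monom n d i e) =
        (\<Sum>k<card (A l). vec_scale (c k) (point_vec m q (lead_monom n d i (?e k))))"
      unfolding point_vec_linear_combination[symmetric] using c q by (intro point_vec_cong) auto
    also have "\<dots> \<in> coord.span (reduced_vecs A n d m q)"
    proof (intro coord.span_sum coord.span_scale less.hyps)
      fix k assume k: "k \<in> {..<card (A l)}"
      show "sum (?e k) {i<..n} < sum e {i<..n}"
        using k l by (intro sum_strict_mono_ex1) auto
      then show "i = n \<or> sum (?e k) {i<..n} < d"
        using d by simp
    qed
    finally show ?thesis .
  qed
qed

section \<open>Homogeneous polynomials as combinations of monomials with a leading variable\<close>

lemma eval_map_eq_point_vec: "eval_map n m p f = point_vec m (\<lambda>k. std_rep n (p k)) (poly_eval f)"
  by (simp add: eval_map_def point_vec_def)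

text \<open>The leading variable is the first with nonzero exponent; that exponent is positive, so
  the later ones sum to less than \<open>d\<close>.\<close>

lemma homogeneous_monomial_eq_lead_monom:
  fixes t :: "nat \<Rightarrow>\<^sub>0 nat"
  assumes "Poly_Mapping.keys t \<subseteq> {0..n}" "monom_degree t = d"
  obtains i where "i \<le> n" "i = n \<or> sum (Poly_Mapping.lookup t) {i<..n} < d"
    "(\<lambda>x :: nat \<Rightarrow> 'a::field. \<Prod>j\<in>Poly_Mapping.keys t. x j ^ Poly_Mapping.lookup t j) =
      lead_monom n d i (Poly_Mapping.lookup t)"
proof -
  let ?t = "Poly_Mapping.lookup t"
  \<comment> \<open>The alternative \<open>i = n\<close> covers the constant monomial, which has no
    variable.\<close>
  define i where "i = (LEAST i. i = n \<or> ?t i \<noteq> 0)"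
  have i: "i = n \<or> ?t i \<noteq> 0"
    unfolding i_def by (rule LeastI[of _ n]) simp
  have "i \<le> n"
    unfolding i_def by (rule Least_le) simp
  have low: "?t j = 0" if "j < i" for j
    using not_less_Least[OF that[unfolded i_def]] by simp
  have keys: "Poly_Mapping.keys t \<subseteq> insert i {i<..n}"
  proof
    fix j assume j: "j \<in> Poly_Mapping.keys t"
    then have "\<not> j < i"
      using low by (auto simp: in_keys_iff)
    then show "j \<in> insert i {i<..n}"
      using j assms(1) by auto
  qed
  have "d = sum ?t (insert i {i<..n})"
    unfolding assms(2)[symmetric] monom_degree_def using keys
    by (intro sum.mono_neutral_left) (auto simp: in_keys_iff)
  then have d: "d = ?t i + sum ?t {i<..n}"
    by simp
  show thesis
  proof (rule that[of i])
    show "i = n \<or> sum ?t {i<..n} < d"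
      using i d by auto
    show "(\<lambda>x :: nat \<Rightarrow> 'a. \<Prod>j\<in>Poly_Mapping.keys t. x j ^ ?t j) = lead_monom n d i ?t"
    proof
      fix x :: "nat \<Rightarrow> 'a"
      have "(\<Prod>j\<in>Poly_Mapping.keys t. x j ^ ?t j) = (\<Prod>j\<in>insert i {i<..n}. x j ^ ?t j)"
        using keys by (intro prod.mono_neutral_left) (auto simp: in_keys_iff)
      then show "(\<Prod>j\<in>Poly_Mapping.keys t. x j ^ ?t j) = lead_monom n d i ?t x"
        using d by (simp add: lead_monom_def)
    qed
  qed fact
qed

text \<open>The exponent of \<open>X_i\<close> fills the degree up to \<open>d\<close>, which the
  bound on the sum permits.\<close>

lemma lead_monom_eq_poly_eval:
  assumes "i \<le> n" "i = n \<or> sum e {i<..n} < d"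
  obtains f where "f \<in> homogeneous_polys n d" "poly_eval f = (lead_monom n d i e :: (nat \<Rightarrow> 'a::field) \<Rightarrow> 'a)"
proof -
  define u where "u = (\<lambda>j. if j = i then d - sum e {i<..n} else if j \<in> {i<..n} then e j else 0)"
  define t where "t = Abs_poly_mapping u"
  have "finite {j. u j \<noteq> 0}"
    by (rule finite_subset[of _ "{i..n}"]) (use assms(1) in \<open>auto simp: u_def split: if_splits\<close>)
  then have lookup_t: "Poly_Mapping.lookup t = u"
    by (simp add: t_def)
  have keys: "Poly_Mapping.keys t \<subseteq> insert i {i<..n}"
    by (auto simp: in_keys_iff lookup_t u_def split: if_splits)
  have "monom_degree t = sum u (insert i {i<..n})"
    unfolding monom_degree_def lookup_t using keys
    by (intro sum.mono_neutral_left) (auto simp: in_keys_iff lookup_t)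
  also have "\<dots> = u i + sum u {i<..n}"
    by simp
  also have "sum u {i<..n} = sum e {i<..n}"
    by (intro sum.cong) (auto simp: u_def)
  finally have deg: "monom_degree t = d"
    using assms by (auto simp: u_def)
  show thesis
  proof (rule that[of "Poly_Mapping.single t 1"])
    show "Poly_Mapping.single t 1 \<in> (homogeneous_polys n d :: 'a mpol set)"
      using keys assms(1) deg by (force simp: homogeneous_polys_def polys_in_def)
    show "poly_eval (Poly_Mapping.single t 1) = (lead_monom n d i e :: (nat \<Rightarrow> 'a) \<Rightarrow> 'a)"
    proof
      fix x :: "nat \<Rightarrow> 'a"
      have "poly_eval (Poly_Mapping.single t 1) x = (\<Prod>j\<in>Poly_Mapping.keys t. x j ^ u j)"
        by (simp add: poly_eval_def lookup_t)
      also have "\<dots> = (\<Prod>j\<in>insert i {i<..n}. x j ^ u j)"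
        using keys by (intro prod.mono_neutral_left) (auto simp: in_keys_iff lookup_t)
      also have "\<dots> = x i ^ u i * (\<Prod>j\<in>{i<..n}. x j ^ u j)"
        by simp
      also have "(\<Prod>j\<in>{i<..n}. x j ^ u j) = (\<Prod>j\<in>{i<..n}. x j ^ e j)"
        by (intro prod.cong) (auto simp: u_def)
      finally show "poly_eval (Poly_Mapping.single t 1) x = lead_monom n d i e x"
        by (simp add: lead_monom_def u_def)
    qed
  qed
qed

lemma span_reduced_vecs:
  fixes A :: "nat \<Rightarrow> 'a::{field,finite} set"
  assumes "projective_nested n A"
    and q: "\<And>k. k \<in> {1..m} \<Longrightarrow> std_rep n (p k) \<in> std_points n A"
  shows "coord.span (reduced_vecs A n d m (\<lambda>k. std_rep n (p k))) = nested_code n m p d"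
proof
  let ?q = "\<lambda>k. std_rep n (p k)"
  show "coord.span (reduced_vecs A n d m ?q) \<subseteq> nested_code n m p d"
  proof (rule coord.span_minimal[OF subsetI subspace_nested_code])
    fix v assume "v \<in> reduced_vecs A n d m ?q"
    then obtain i e where v: "v = point_vec m ?q (lead_monom n d i e)"
      and "i \<le> n" "i = n \<or> sum e {i<..n} < d"
      by (auto simp: reduced_vecs_def reduced_exponents_def)
    from this(2,3) obtain f where "f \<in> homogeneous_polys n d"
      "poly_eval f = (lead_monom n d i e :: (nat \<Rightarrow> 'a) \<Rightarrow> 'a)"
      by (rule lead_monom_eq_poly_eval)
    then show "v \<in> nested_code n m p d"
      unfolding v nested_code_def eval_map_eq_point_vec by force
  qed
  show "nested_code n m p d \<subseteq> coord.span (reduced_vecs A n d m ?q)"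
  proof (unfold nested_code_def, clarify)
    fix f :: "'a mpol" assume f: "f \<in> homogeneous_polys n d"
    have "eval_map n m p f = (\<Sum>t\<in>Poly_Mapping.keys f. vec_scale (Poly_Mapping.lookup f t)
        (point_vec m ?q (\<lambda>x. \<Prod>j\<in>Poly_Mapping.keys t. x j ^ Poly_Mapping.lookup t j)))"
      unfolding eval_map_eq_point_vec point_vec_linear_combination[symmetric]
      by (simp add: poly_eval_def[abs_def])
    also have "\<dots> \<in> coord.span (reduced_vecs A n d m ?q)"
    proof (intro coord.span_sum coord.span_scale)
      fix t assume "t \<in> Poly_Mapping.keys f"
      then have "Poly_Mapping.keys t \<subseteq> {0..n}" "monom_degree t = d"
        using f by (auto simp: homogeneous_polys_def polys_in_def)
      then obtain i where i: "i \<le> n" "i = n \<or> sum (Poly_Mapping.lookup t) {i<..n} < d"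
        and *: "(\<lambda>x :: nat \<Rightarrow> 'a. \<Prod>j\<in>Poly_Mapping.keys t. x j ^ Poly_Mapping.lookup t j) =
          lead_monom n d i (Poly_Mapping.lookup t)"
        by (rule homogeneous_monomial_eq_lead_monom[where 'a = 'a])
      show "point_vec m ?q (\<lambda>x. \<Prod>j\<in>Poly_Mapping.keys t. x j ^ Poly_Mapping.lookup t j)
          \<in> coord.span (reduced_vecs A n d m ?q)"
        unfolding * using lead_monom_in_span[OF assms i] .
    qed
    finally show "eval_map n m p f \<in> coord.span (reduced_vecs A n d m ?q)" .
  qed
qed

text \<open>Two equal members would satisfy a relation with coefficients 1 and -1. Injectivity lets
  the basis be counted by its index set.\<close>

lemma (in vector_space) independent_family:
  assumes "finite I"
    and zero: "\<And>c i. (\<Sum>i\<in>I. scale (c i) (w i)) = 0 \<Longrightarrow> i \<in> I \<Longrightarrow> c i = 0"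
  shows "inj_on w I" "independent (w ` I)"
proof -
  show inj: "inj_on w I"
  proof (rule inj_onI, rule ccontr)
    fix i j assume ij: "i \<in> I" "j \<in> I" "w i = w j" "i \<noteq> j"
    let ?c = "\<lambda>k. if k = i then 1 else if k = j then - 1 else 0"
    have "(\<Sum>k\<in>I. scale (?c k) (w k)) = (\<Sum>k\<in>{i, j}. scale (?c k) (w k))"
      using ij assms(1) by (intro sum.mono_neutral_right) auto
    also have "\<dots> = 0"
      using ij by simp
    finally show False
      using zero[of ?c i] ij(1) by simp
  qed
  show "independent (w ` I)"
  proof (rule independent_if_scalars_zero)
    fix f x assume "(\<Sum>x\<in>w ` I. scale (f x) x) = 0" "x \<in> w ` I"
    then show "f x = 0"
      using zero[of "f \<circ> w"] by (auto simp: sum.reindex[OF inj])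
  qed (use assms(1) in simp)
qed

lemma finite_reduced_exponents: "finite (reduced_exponents A n d i)"
  unfolding reduced_exponents_def by (rule finite_Collect_conjI) (auto intro: finite_PiE)

lemma dim_nested_code:
  fixes A :: "nat \<Rightarrow> 'a::{field,finite} set"
  assumes "projective_nested n A"
    and q: "(\<lambda>k. std_rep n (p k)) ` {1..m} = std_points n A"
  shows "coord.dim (nested_code n m p d) = (\<Sum>i\<le>n. card (reduced_exponents A n d i))"
proof -
  let ?q = "\<lambda>k. std_rep n (p k)"
  let ?I = "SIGMA i:{..n}. reduced_exponents A n d i"
  let ?w = "\<lambda>(i, e). point_vec m ?q (lead_monom n d i e)"
  have "c s = 0" if sum0: "(\<Sum>s\<in>?I. vec_scale (c s) (?w s)) = 0" and s: "s \<in> ?I" for c s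
  proof -
    obtain i e where ie: "s = (i, e)"
      by force
    have "c (i, e) = 0"
    proof (rule lead_monoms_independent[where A = A and c = "\<lambda>i e. c (i, e)"])
      fix x assume "x \<in> std_points n A"
      \<comment> \<open>Every point is some \<open>?q k\<close>, so a vanishing combination of the
        vectors, read at coordinate \<open>k\<close>, vanishes at \<open>x\<close>.\<close>
      then obtain k where k: "k \<in> {1..m}" "x = ?q k"
        unfolding q[symmetric] by blast
      have "(\<Sum>i\<le>n. \<Sum>e\<in>reduced_exponents A n d i. c (i, e) * lead_monom n d i e x) =
          (\<Sum>(i, e)\<in>?I. c (i, e) * lead_monom n d i e x)"
        by (rule sum.Sigma) (auto simp: finite_reduced_exponents)
      also have "\<dots> = (\<Sum>s\<in>?I. vec_scale (c s) (?w s)) k"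
        using k by (auto simp: sum_fun_apply vec_scale_def point_vec_def intro!: sum.cong)
      finally show "(\<Sum>i\<le>n. \<Sum>e\<in>reduced_exponents A n d i. c (i, e) * lead_monom n d i e x) = 0"
        by (simp add: sum0)
    qed (use s ie in auto)
    then show ?thesis
      by (simp add: ie)
  qed
  then have "inj_on ?w ?I" "coord.independent (?w ` ?I)"
    using coord.independent_family[of ?I ?w] by (simp_all add: finite_reduced_exponents)
  moreover have "coord.span (?w ` ?I) = coord.span (nested_code n m p d)"
    unfolding reduced_vecs_def[symmetric] coord.span_eq_iff[THEN iffD2, OF subspace_nested_code]
    using q by (intro span_reduced_vecs[OF assms(1)]) blast
  ultimately have "coord.dim (nested_code n m p d) = card ?I"
    by (simp add: coord.dim_eq_card card_image)
  then show ?thesis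
    by (simp add: finite_reduced_exponents)
qed

section \<open>Counting exponents\<close>

text \<open>The bound is an integer because the recursion below subtracts from it beyond zero.\<close>

definition bounded_exponents :: "(nat \<Rightarrow> nat) \<Rightarrow> nat set \<Rightarrow> int \<Rightarrow> (nat \<Rightarrow> nat) set" where
  "bounded_exponents \<delta> L D = {e \<in> PiE L (\<lambda>l. {..<\<delta> l}). int (sum e L) < D}"

lemma card_bounded_exponents_insert:
  assumes "finite L" "a \<notin> L"
  shows "card (bounded_exponents \<delta> (insert a L) D) =
    (\<Sum>k<\<delta> a. card (bounded_exponents \<delta> L (D - int k)))"
proof -
  let ?S = "SIGMA k:{..<\<delta> a}. bounded_exponents \<delta> L (D - int k)"
  have sum_upd: "sum (e(a := k)) (insert a L) = k + sum e L" for e :: "nat \<Rightarrow> nat" and k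
  proof -
    have "sum (e(a := k)) L = sum e L"
      using assms by (intro sum.cong) auto
    then show ?thesis
      using assms by simp
  qed
  have "bounded_exponents \<delta> (insert a L) D = (\<lambda>(y, g). g(a := y)) ` ?S"
  proof (intro equalityI subsetI)
    fix f assume f: "f \<in> bounded_exponents \<delta> (insert a L) D"
    then obtain k g where kg: "k < \<delta> a" "g \<in> PiE L (\<lambda>l. {..<\<delta> l})" "f = g(a := k)"
      unfolding bounded_exponents_def PiE_insert_eq by auto
    have "int k + int (sum g L) < D"
      using f unfolding kg(3) bounded_exponents_def mem_Collect_eq sum_upd by simp
    then show "f \<in> (\<lambda>(y, g). g(a := y)) ` ?S"
      using kg by (intro image_eqI[of _ _ "(k, g)"]) (auto simp: bounded_exponents_def)
  next
    fix f assume "f \<in> (\<lambda>(y, g). g(a := y)) ` ?S"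
    then obtain k g where kg: "k < \<delta> a" "g \<in> bounded_exponents \<delta> L (D - int k)" "f = g(a := k)"
      by auto
    then have "f \<in> PiE (insert a L) (\<lambda>l. {..<\<delta> l})"
      unfolding PiE_insert_eq by (auto simp: bounded_exponents_def)
    moreover have "int (sum f (insert a L)) < D"
      using kg(2) unfolding kg(3) bounded_exponents_def mem_Collect_eq sum_upd by simp
    ultimately show "f \<in> bounded_exponents \<delta> (insert a L) D"
      by (simp add: bounded_exponents_def)
  qed
  moreover have "inj_on (\<lambda>(y, g). g(a := y)) ?S"
    by (rule inj_on_subset[OF inj_combinator[OF assms(2), of "\<lambda>l. {..<\<delta> l}"]])
       (auto simp: bounded_exponents_def)
  ultimately have "card (bounded_exponents \<delta> (insert a L) D) = card ?S"
    by (simp add: card_image)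
  also have "\<dots> = (\<Sum>k<\<delta> a. card (bounded_exponents \<delta> L (D - int k)))"
    using assms(1) by (subst card_SigmaI) (auto simp: bounded_exponents_def intro!: finite_Collect_conjI finite_PiE)
  finally show ?thesis .
qed

text \<open>For \<open>D > 0\<close> this is Pascal's rule; at \<open>D = 0\<close> it reads 1 - 0 =
  1, and below that all terms are 0.\<close>

lemma int_binomial_pascal:
  "int_binomial (int (Suc j) + D) D - int_binomial (int (Suc j) + (D - 1)) (D - 1) =
    int_binomial (int j + D) D"
proof (cases "D > 0")
  case True
  define e where "e = nat D - 1"
  have "D = int (Suc e)"
    using True by (simp add: e_def)
  moreover have "nat (int (Suc j) + int (Suc e)) = Suc (Suc (j + e))"
    "nat (int (Suc j) + (int (Suc e) - 1)) = Suc (j + e)"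
    "nat (int j + int (Suc e)) = Suc (j + e)" "nat (1 + int e) = Suc e"
    by auto
  ultimately show ?thesis
    by (simp add: int_binomial_def)
next
  case False
  then show ?thesis
    by (cases "D = 0") (auto simp: int_binomial_def)
qed

text \<open>Pascal's rule summed over the \<open>t\<close> values from \<open>D\<close>
  downwards.\<close>

lemma int_binomial_telescope:
  "int_binomial (int (Suc j) + D) D - int_binomial (int (Suc j) + (D - int t)) (D - int t) =
    (\<Sum>k<t. int_binomial (int j + (D - int k)) (D - int k))"
proof (induction t)
  case (Suc t)
  then show ?case
    using int_binomial_pascal[of j "D - int t"] by (simp add: algebra_simps)
qed simp

text \<open>Inclusion-exclusion over the set \<open>I\<close> of variables whose bound is violated:
  without upper bounds, \<open>int_binomial (j + (D - 1)) (D - 1)\<close> counts the exponents in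
  \<open>j\<close> variables with sum below \<open>D\<close>.\<close>

lemma card_bounded_exponents:
  assumes "finite L"
  shows "int (card (bounded_exponents \<delta> L D)) =
    (\<Sum>I\<in>Pow L. (-1) ^ card I *
      int_binomial (int (card L) + (D - 1 - (\<Sum>i\<in>I. int (\<delta> i)))) (D - 1 - (\<Sum>i\<in>I. int (\<delta> i))))"
  using assms
proof (induction L arbitrary: D rule: finite_induct)
  case empty
  then show ?case
    by (auto simp: bounded_exponents_def int_binomial_def)
next
  case (insert a L)
  let ?s = "\<lambda>I. \<Sum>i\<in>I. int (\<delta> i)"
  let ?b = "\<lambda>j D. int_binomial (int j + D) D"
  let ?j = "card L"
  have fin: "finite I" "a \<notin> I" if "I \<in> Pow L" for I
    using that insert.hyps finite_subset by auto
  have inj: "inj_on (insert a) (Pow L)"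
    using insert.hyps(2) by (auto simp: inj_on_def)
  have "(\<Sum>I\<in>Pow (insert a L). (-1) ^ card I * ?b (Suc ?j) (D - 1 - ?s I)) =
      (\<Sum>I\<in>Pow L. (-1) ^ card I * ?b (Suc ?j) (D - 1 - ?s I)) +
      (\<Sum>I\<in>Pow L. (-1) ^ card (insert a I) * ?b (Suc ?j) (D - 1 - ?s (insert a I)))"
    unfolding Pow_insert using insert.hyps
    by (subst sum.union_disjoint) (auto simp: sum.reindex[OF inj])
  \<comment> \<open>Pairing \<open>I\<close> with \<open>insert a I\<close> gives opposite signs and
    arguments differing by \<open>\<delta> a\<close>, the left side of the telescoping
    identity.\<close>
  also have "\<dots> = (\<Sum>I\<in>Pow L. (-1) ^ card I *
      (?b (Suc ?j) (D - 1 - ?s I) - ?b (Suc ?j) (D - 1 - ?s I - int (\<delta> a))))"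
    unfolding sum.distrib[symmetric]
    by (intro sum.cong refl) (simp add: fin algebra_simps)
  also have "\<dots> = (\<Sum>I\<in>Pow L. \<Sum>k<\<delta> a. (-1) ^ card I * ?b ?j (D - int k - 1 - ?s I))"
    unfolding int_binomial_telescope sum_distrib_left by (simp add: algebra_simps)
  also have "\<dots> = (\<Sum>k<\<delta> a. int (card (bounded_exponents \<delta> L (D - int k))))"
    unfolding insert.IH by (rule sum.swap)
  also have "\<dots> = int (card (bounded_exponents \<delta> (insert a L) D))"
    using insert.hyps by (simp add: card_bounded_exponents_insert)
  finally show ?case
    using insert.hyps by simp
qed

lemma sum_Pow_by_card:
  assumes "finite L"
  shows "(\<Sum>I\<in>Pow L. (-1) ^ card I * f I) =
    (\<Sum>k=0..card L. (-1) ^ k * (\<Sum>I | I \<subseteq> L \<and> card I = k. f I :: int))"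
proof -
  have "(\<Sum>I\<in>Pow L. (-1) ^ card I * f I) =
      (\<Sum>k=0..card L. \<Sum>I\<in>{I \<in> Pow L. card I = k}. (-1) ^ card I * f I)"
    using assms by (intro sum.group[symmetric]) (auto intro: card_mono)
  then show ?thesis
    by (simp add: sum_distrib_left)
qed

section \<open>Length and dimension of the projective nested cartesian code\<close>

theorem theorem2p8:
  fixes A :: "nat \<Rightarrow> 'a::{field,finite} set"
    and p :: "nat \<Rightarrow> (nat \<Rightarrow> 'a) set"
    and \<delta> :: "nat \<Rightarrow> nat"
    and n d m :: nat
  assumes "n \<ge> 1"
    and "\<And>i. i \<le> n \<Longrightarrow> \<delta> i = card (A i)"
    and "2 \<le> \<delta> 0"
    and "\<And>i. i < n \<Longrightarrow> \<delta> i \<le> \<delta> (Suc i)"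
    and "projective_nested n A"
    and "m = card (cartesian_points n A)"
    and "bij_betw p {1..m} (cartesian_points n A)"
  shows "m = 1 + (\<Sum>i=1..n. (\<Prod>l=i..n. \<delta> l)) \<and>
    int (coord.dim (nested_code n m p d)) =
      1 + (\<Sum>j=1..n. \<Sum>k=0..j. (-1) ^ k *
        (\<Sum>I | I \<subseteq> {n + 1 - j..n} \<and> card I = k.
          int_binomial (int j + int d - 1 - (\<Sum>i\<in>I. int (\<delta> i)))
                       (int d - 1 - (\<Sum>i\<in>I. int (\<delta> i)))))"
proof -
  have \<delta>: "\<delta> i = card (A i)" if "i \<le> n" for i
    using assms(2) that .
  have "2 \<le> \<delta> i" if "i \<le> n" for i
    using that
  proof (induction i)
    case (Suc i)
    then show ?case
      using assms(4)[of i] by simp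
  qed (use assms(3) in simp)
  then have bij: "bij_betw (std_rep n) (cartesian_points n A) (std_points n A)"
    using assms(5) \<delta> by (intro bij_betw_std_rep) auto
  have q: "(\<lambda>k. std_rep n (p k)) ` {1..m} = std_points n A"
    using bij_betw_trans[OF assms(7) bij] by (simp add: bij_betw_def o_def)
  have "m = 1 + (\<Sum>i=1..n. \<Prod>l=i..n. card (A l))"
    using bij_betw_same_card[OF bij] assms(6) by (simp add: card_std_points)
  also have "\<dots> = 1 + (\<Sum>i=1..n. \<Prod>l=i..n. \<delta> l)"
    by (simp add: \<delta>)
  finally have length: "m = 1 + (\<Sum>i=1..n. \<Prod>l=i..n. \<delta> l)" .
  \<comment> \<open>After leading index \<open>n - j\<close> exactly \<open>j\<close> variables
    follow, and \<open>j \<ge> 1\<close> excludes the exceptional case \<open>i = n\<close>.\<close>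
  have exps: "reduced_exponents A n d (n - j) = bounded_exponents \<delta> {n + 1 - j..n} (int d)"
    if "j \<in> {1..n}" for j
  proof -
    have "{n - j<..n} = {n + 1 - j..n}" "n - j \<noteq> n"
      using that by auto
    moreover have "PiE {n + 1 - j..n} (\<lambda>l. {..<card (A l)}) = PiE {n + 1 - j..n} (\<lambda>l. {..<\<delta> l})"
      by (intro PiE_cong) (simp add: \<delta>)
    ultimately show ?thesis
      unfolding reduced_exponents_def bounded_exponents_def by (simp del: of_nat_sum)
  qed
  have "coord.dim (nested_code n m p d) = (\<Sum>i\<le>n. card (reduced_exponents A n d i))"
    by (rule dim_nested_code[OF assms(5) q])
  also have "\<dots> = (\<Sum>j=0..n. card (reduced_exponents A n d (n - j)))"
    by (rule sum.reindex_bij_witness[of _ "\<lambda>j. n - j" "\<lambda>j. n - j"]) auto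
  \<comment> \<open>The term \<open>j = 0\<close> counts the single monomial \<open>X_n ^ d\<close>,
    which for \<open>d = 0\<close> is the constant.\<close>
  also have "\<dots> = 1 + (\<Sum>j=1..n. card (bounded_exponents \<delta> {n + 1 - j..n} (int d)))"
    using exps by (simp add: sum.atLeast_Suc_atMost) (simp add: reduced_exponents_def)
  finally have "int (coord.dim (nested_code n m p d)) =
      1 + (\<Sum>j=1..n. int (card (bounded_exponents \<delta> {n + 1 - j..n} (int d))))"
    by simp
  also have "(\<Sum>j=1..n. int (card (bounded_exponents \<delta> {n + 1 - j..n} (int d)))) =
      (\<Sum>j=1..n. \<Sum>k=0..j. (-1) ^ k *
        (\<Sum>I | I \<subseteq> {n + 1 - j..n} \<and> card I = k.
          int_binomial (int j + int d - 1 - (\<Sum>i\<in>I. int (\<delta> i)))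
                       (int d - 1 - (\<Sum>i\<in>I. int (\<delta> i)))))"
  proof (rule sum.cong[OF refl])
    fix j assume "j \<in> {1..n}"
    then have "card {n + 1 - j..n} = j"
      by auto
    then show "int (card (bounded_exponents \<delta> {n + 1 - j..n} (int d))) = (\<Sum>k=0..j. (-1) ^ k *
        (\<Sum>I | I \<subseteq> {n + 1 - j..n} \<and> card I = k.
          int_binomial (int j + int d - 1 - (\<Sum>i\<in>I. int (\<delta> i)))
                       (int d - 1 - (\<Sum>i\<in>I. int (\<delta> i)))))"
      by (simp add: card_bounded_exponents sum_Pow_by_card algebra_simps)
  qed
  finally show ?thesis
    using length by blast
qed

end
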